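(* Let $\sigma\overline{\mathrm{mex}}(n)=\sum_{\pi}\overline{\mathrm{mex}}(\pi)$ over all overpartitions $\pi$ of $n$ for $n\ge1$, and $\sigma\overline{\mathrm{mex}}(0)=1$. Then, as formal power series in $q$, \[\sum_{n=0}^\infty \sigma\overline{\mathrm{mex}}(n)\,q^n=\frac{(-q;q)_\infty}{(q;q)_\infty}\sum_{m=0}^\infty\frac{2^m q^{\binom{m+1}{2}}}{(-q;q)_m}=\overline{P}(q)\,{}_1\phi_1(q;-q;q,-2q),\] where $\overline{P}(q)=\frac{(-q;q)_\infty}{(q;q)_\infty}$ is the generating function for the overpartition numbers and ${}_1\phi_1(q;-q;q,-2q)=\sum_{n=0}^\infty \frac{2^n q^{\binom{n+1}{2}}}{(-q;q)_n}$.
   Context: An overpartition of a positive integer $n$ is a non-increasing sequence of positive integers summing to $n$ in which the first occurrence of each number may (or may not) be overlined. For an overpartition $\pi$, $\overline{\mathrm{mex}}(\pi)$ is the smallest positive integer that does not occur as a part of $\pi$, whether overlined or non-overlined. Notation: $(a;q)_m=\prod_{k=0}^{m-1}(1-aq^k)$, $(a;q)_\infty=\prod_{k\ge0}(1-aq^k)$. The unilateral basic hypergeometric series is ${}_1\phi_1(a;b;q,z)=\sum_{n\ge0}\frac{(a;q)_n}{(b;q)_n(q;q)_n}(-1)^nq^{\binom n2}z^n$. *)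

theory Defs
  imports "HOL-Analysis.Analysis" "HOL-Computational_Algebra.Formal_Power_Series"
begin

text \<open>
  A part is a pair of its size and a flag telling whether it is overlined. An overlined part
  must be the first occurrence of its size. The only overpartition of 0 is the empty one.
\<close>

definition overpartitions :: "nat \<Rightarrow> (nat \<times> bool) list set" where
  "overpartitions n =
     {\<pi>. sorted_wrt (\<ge>) (map fst \<pi>) \<and>
         (\<forall>p\<in>set \<pi>. fst p > 0) \<and>
         sum_list (map fst \<pi>) = n \<and>
         (\<forall>i<length \<pi>. snd (\<pi> ! i) \<longrightarrow> (\<forall>j<i. fst (\<pi> ! j) \<noteq> fst (\<pi> ! i)))}"

definition overmex :: "(nat \<times> bool) list \<Rightarrow> nat" where
  "overmex \<pi> = (LEAST m. m > 0 \<and> m \<notin> fst ` set \<pi>)"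

definition sigma_overmex :: "nat \<Rightarrow> nat" where
  "sigma_overmex n = (if n = 0 then 1 else \<Sum>\<pi>\<in>overpartitions n. overmex \<pi>)"

definition overpartition_gf :: "'a::field_char_0 fps" where
  "overpartition_gf = Abs_fps (\<lambda>n. of_nat (card (overpartitions n)))"

text \<open>
  Infinite sums and products of formal power series are limits of the partial ones with
  respect to the library's metric on \<^typ>\<open>'a fps\<close>, which is the \<open>X\<close>-adic one.
\<close>

definition qpoch :: "'a::field fps \<Rightarrow> 'a fps \<Rightarrow> nat \<Rightarrow> 'a fps" where
  "qpoch a q m = (\<Prod>k<m. 1 - a * q ^ k)"

definition qpoch_inf :: "'a::field fps \<Rightarrow> 'a fps \<Rightarrow> 'a fps" where
  "qpoch_inf a q = (\<Prod>k. 1 - a * q ^ k)"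

definition phi_1_1 :: "'a::field fps \<Rightarrow> 'a fps \<Rightarrow> 'a fps \<Rightarrow> 'a fps \<Rightarrow> 'a fps" where
  "phi_1_1 a b q z =
     (\<Sum>n. qpoch a q n / (qpoch b q n * qpoch q q n) * (-1) ^ n * q ^ (n choose 2) * z ^ n)"

end

theory Submission
  imports Defs
begin

text \<open>
  The overpartitions containing all the sizes \<open>1, \<dots>, m\<close> are generated by
  \<open>(\<Prod>k\<le>m. 2q\<^sup>k / (1 - q\<^sup>k)) \<cdot> (\<Prod>k>m. (1 + q\<^sup>k) / (1 - q\<^sup>k))\<close>: there are two ways to use a size
  a given positive number of times. This product equals the overpartition generating function
  times \<open>2\<^sup>m q\<^bsup>m(m+1)/2\<^esup> / (-q; q)\<^sub>m\<close>. An overpartition with mex \<open>k\<close> contains \<open>1, \<dots>, m\<close> for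
  exactly the \<open>k\<close> values \<open>m < k\<close>, so summing over \<open>m\<close> counts every overpartition with its mex.
  With parts of size at most \<open>N\<close> all products are finite, and \<open>N\<close> then tends to infinity.
\<close>

unbundle no vec_syntax
unbundle fps_syntax

section \<open>Limits of formal power series\<close>

text \<open>Coefficient \<open>n\<close> of a product involves only coefficients up to
  \<open>n\<close> of the factors, and these finitely many are all eventually constant.\<close>

lemma tendsto_fps_mult:
  fixes f g :: "'b \<Rightarrow> 'a::ring fps"
  assumes "(f \<longlongrightarrow> a) F" "(g \<longlongrightarrow> b) F"
  shows "((\<lambda>x. f x * g x) \<longlongrightarrow> a * b) F"
proof (rule tendsto_fpsI)
  fix n
  have "eventually (\<lambda>x. \<forall>i\<in>{..n}. f x $ i = a $ i) F" "eventually (\<lambda>x. \<forall>i\<in>{..n}. g x $ i = b $ i) F"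
    using assms by (auto simp: tendsto_fps_iff eventually_ball_finite_distrib)
  then show "eventually (\<lambda>x. (f x * g x) $ n = (a * b) $ n) F"
    by eventually_elim (auto simp: fps_mult_nth intro!: sum.cong)
qed

lemma qpoch_nth_0:
  assumes "a $ 0 = 0"
  shows "qpoch a fps_X n $ 0 = 1"
  using assms by (induction n) (auto simp: qpoch_def)

text \<open>Factors with exponent \<open>k > n\<close> cannot change coefficient \<open>n\<close>.
  The factor \<open>k = n\<close> still can when \<open>a\<close> has a constant term, hence the
  index \<open>Suc n\<close>.\<close>

lemma qpoch_nth_stable:
  assumes "n \<le> m"
  shows "qpoch a fps_X (Suc m) $ n = qpoch a fps_X (Suc n) $ n"
  using assms
proof (induction m rule: dec_induct)
  case (step m)
  have "qpoch a fps_X (Suc (Suc m))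
          = qpoch a fps_X (Suc m) - fps_X ^ Suc m * (qpoch a fps_X (Suc m) * a)"
    by (simp add: qpoch_def algebra_simps)
  then have "qpoch a fps_X (Suc (Suc m)) $ n = qpoch a fps_X (Suc m) $ n"
    using step.hyps by (simp only: fps_sub_nth fps_X_power_mult_nth) auto
  then show ?case using step.IH by simp
qed auto

lemma qpoch_inf_limit:
  fixes a :: "'a::field fps"
  assumes a: "a $ 0 = 0"
  shows "qpoch a fps_X \<longlonglongrightarrow> qpoch_inf a fps_X" "qpoch_inf a fps_X $ 0 = 1"
proof -
  define L where "L = Abs_fps (\<lambda>n. qpoch a fps_X (Suc n) $ n)"
  have L0: "L $ 0 = 1"
    using qpoch_nth_0[OF a] by (simp add: L_def)
  have lim: "(\<lambda>n. qpoch a fps_X (Suc n)) \<longlonglongrightarrow> L"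
  proof (rule tendsto_fpsI)
    fix n
    show "eventually (\<lambda>m. qpoch a fps_X (Suc m) $ n = L $ n) sequentially"
      using eventually_ge_at_top[of n] by eventually_elim (unfold L_def fps_nth_Abs_fps, rule qpoch_nth_stable)
  qed
  \<comment> \<open>\<open>raw_has_prod\<close> demands a nonzero limit, which \<open>L0\<close>
    supplies; its partial products run over \<open>{..n}\<close>, hence the shift by one in
    \<open>lim\<close>.\<close>
  have "(\<lambda>k. 1 - a * fps_X ^ k) has_prod L"
    using lim L0 by (auto simp: has_prod_def raw_has_prod_def qpoch_def lessThan_Suc_atMost)
  then have "L = qpoch_inf a fps_X"
    unfolding qpoch_inf_def by (rule has_prod_unique)
  with lim L0 show "qpoch a fps_X \<longlonglongrightarrow> qpoch_inf a fps_X" "qpoch_inf a fps_X $ 0 = 1"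
    using filterlim_sequentially_Suc by auto
qed

section \<open>Generating functions of sets of overpartitions\<close>

definition weight :: "(nat \<times> bool) list \<Rightarrow> nat" where
  "weight \<pi> = sum_list (map fst \<pi>)"

text \<open>Meaningful only if every weight has finitely many lists in the set: \<^const>\<open>card\<close> is 0 otherwise.\<close>

definition weight_gf :: "(nat \<times> bool) list set \<Rightarrow> 'a::comm_semiring_1 fps" where
  "weight_gf A = Abs_fps (\<lambda>n. of_nat (card {\<pi>\<in>A. weight \<pi> = n}))"

lemma weight_append [simp]: "weight (xs @ ys) = weight xs + weight ys"
  by (simp add: weight_def)

lemma fst_le_weight: "p \<in> set \<pi> \<Longrightarrow> fst p \<le> weight \<pi>"
  unfolding weight_def by (rule member_le_sum_list) auto

lemma length_le_weight: "\<forall>p\<in>set \<pi>. 0 < fst p \<Longrightarrow> length \<pi> \<le> weight \<pi>"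
  by (induction \<pi>) (auto simp: weight_def Suc_le_eq)

lemma finite_weight:
  assumes "\<And>\<pi> p. \<pi> \<in> A \<Longrightarrow> p \<in> set \<pi> \<Longrightarrow> 0 < fst p"
  shows "finite {\<pi>\<in>A. weight \<pi> = n}"
proof (rule finite_subset)
  show "{\<pi>\<in>A. weight \<pi> = n} \<subseteq> {\<pi>. set \<pi> \<subseteq> {..n} \<times> UNIV \<and> length \<pi> \<le> n}"
    using assms fst_le_weight length_le_weight by fastforce
  show "finite {\<pi>. set \<pi> \<subseteq> {..n} \<times> (UNIV :: bool set) \<and> length \<pi> \<le> n}"
    by (intro finite_lists_length_le) auto
qed

text \<open>By injectivity each list splits in only one way, so sorting by the weight of the prefix
  gives the Cauchy product. Positive parts make every fibre finite, so that \<open>card\<close> is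
  additive.\<close>

lemma weight_gf_append:
  assumes inj: "inj_on (\<lambda>(a, b). a @ b) (A \<times> B)"
    and A: "\<And>\<pi> p. \<pi> \<in> A \<Longrightarrow> p \<in> set \<pi> \<Longrightarrow> 0 < fst p"
    and B: "\<And>\<pi> p. \<pi> \<in> B \<Longrightarrow> p \<in> set \<pi> \<Longrightarrow> 0 < fst p"
  shows "weight_gf ((\<lambda>(a, b). a @ b) ` (A \<times> B)) = weight_gf A * weight_gf B"
proof (rule fps_ext)
  fix n
  let ?f = "\<lambda>(a, b). a @ b" and ?F = "\<lambda>A n. {\<pi>\<in>A. weight \<pi> = n}"
  have "?F (?f ` (A \<times> B)) n = ?f ` (\<Union>i\<in>{0..n}. ?F A i \<times> ?F B (n - i))"
    by (auto simp: image_iff)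
  also have "card \<dots> = card (\<Union>i\<in>{0..n}. ?F A i \<times> ?F B (n - i))"
    by (rule card_image[OF inj_on_subset[OF inj]]) auto
  also have "\<dots> = (\<Sum>i\<in>{0..n}. card (?F A i \<times> ?F B (n - i)))"
    by (rule card_UN_disjoint) (auto simp: finite_weight[of A] finite_weight[of B] A B)
  finally show "weight_gf (?f ` (A \<times> B)) $ n = (weight_gf A * weight_gf B) $ n"
    by (simp add: weight_gf_def fps_mult_nth card_cartesian_product)
qed

section \<open>Overpartitions cut into blocks of equal parts\<close>

definition ovp_rel :: "nat \<times> bool \<Rightarrow> nat \<times> bool \<Rightarrow> bool" where
  "ovp_rel x y \<longleftrightarrow> fst y \<le> fst x \<and> (snd y \<longrightarrow> fst y < fst x)"

text \<open>An overlined part is a first occurrence exactly when all earlier parts, already at least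
  as large, are strictly larger. This pairwise form of the condition can be checked piecewise on
  appended lists.\<close>

lemma overpartitions_altdef:
  "overpartitions n = {\<pi>. sorted_wrt ovp_rel \<pi> \<and> (\<forall>p\<in>set \<pi>. 0 < fst p) \<and> weight \<pi> = n}"
  unfolding overpartitions_def weight_def ovp_rel_def sorted_wrt_map sorted_wrt_iff_nth_less
  by (fastforce simp: le_less)

lemma finite_overpartitions: "finite (overpartitions n)"
  using finite_weight[of "{\<pi>. sorted_wrt ovp_rel \<pi> \<and> (\<forall>p\<in>set \<pi>. 0 < fst p)}" n]
  by (simp add: overpartitions_altdef conj_assoc)

definition ovp_containing :: "nat \<Rightarrow> (nat \<times> bool) list set" where
  "ovp_containing m =
     {\<pi>. sorted_wrt ovp_rel \<pi> \<and> (\<forall>p\<in>set \<pi>. 0 < fst p) \<and> {1..m} \<subseteq> fst ` set \<pi>}"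

text \<open>The cap \<open>min m N\<close> lets a recursion on \<open>N\<close> start at 0: below
  \<open>m\<close>, only the sizes that are allowed are required.\<close>

definition ovp_le :: "nat \<Rightarrow> nat \<Rightarrow> (nat \<times> bool) list set" where
  "ovp_le N m = {\<pi>. sorted_wrt ovp_rel \<pi> \<and> (\<forall>p\<in>set \<pi>. 0 < fst p \<and> fst p \<le> N) \<and>
     {1..min m N} \<subseteq> fst ` set \<pi>}"

definition ovp_block :: "nat \<Rightarrow> nat \<Rightarrow> (nat \<times> bool) list set" where
  "ovp_block N m = {\<pi>. sorted_wrt ovp_rel \<pi> \<and> (\<forall>p\<in>set \<pi>. fst p = N) \<and> (N \<le> m \<longrightarrow> \<pi> \<noteq> [])}"

lemma ovp_le_0: "ovp_le 0 m = {[]}"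
  by (auto simp: ovp_le_def) (metis list.set_intros(1) neq_Nil_conv not_gr_zero surj_pair fst_conv leD)

lemma takeWhile_block:
  assumes "\<forall>p\<in>set xs. fst p = Suc N" "\<forall>p\<in>set ys. fst p \<le> N"
  shows "takeWhile (\<lambda>p. fst p = Suc N) (xs @ ys) = xs"
proof -
  have "takeWhile (\<lambda>p. fst p = Suc N) ys = []"
    using assms(2) by (cases ys) auto
  then show ?thesis using assms(1) by simp
qed

text \<open>Parts of the largest size form a prefix. The containment condition splits accordingly:
  the prefix must be nonempty if \<open>Suc N <= m\<close>, and the remaining sizes must occur in
  the tail.\<close>

lemma ovp_le_Suc:
  "ovp_le (Suc N) m = (\<lambda>(a, b). a @ b) ` (ovp_block (Suc N) m \<times> ovp_le N m)" (is "?L = ?R")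
proof (intro equalityI subsetI)
  fix \<pi> assume \<pi>: "\<pi> \<in> ?L"
  define a b where "a = takeWhile (\<lambda>p. fst p = Suc N) \<pi>" "b = dropWhile (\<lambda>p. fst p = Suc N) \<pi>"
  have ab: "\<pi> = a @ b" by (simp add: a_b_def)
  have a: "\<forall>p\<in>set a. fst p = Suc N" unfolding a_b_def by (auto dest: set_takeWhileD)
  have s: "sorted_wrt ovp_rel a" "sorted_wrt ovp_rel b"
    using \<pi> unfolding ovp_le_def ab by (auto simp: sorted_wrt_append)
  have pos: "\<forall>p\<in>set b. 0 < fst p \<and> fst p \<le> Suc N"
    using \<pi> unfolding ovp_le_def ab by auto
  \<comment> \<open>The head of \<open>b\<close> has a size other than \<open>Suc N\<close>, hence
    at most \<open>N\<close>, and sortedness passes this bound to the rest.\<close>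
  have b: "\<forall>p\<in>set b. fst p \<le> N"
  proof (cases b)
    case (Cons x xs)
    have "fst x \<noteq> Suc N"
      using hd_dropWhile[of "\<lambda>p. fst p = Suc N" \<pi>] Cons a_b_def(2)
      by (metis list.distinct(1) list.sel(1))
    then show ?thesis using pos s(2) Cons by (fastforce simp: ovp_rel_def)
  qed auto
  have cover: "{1..min m (Suc N)} \<subseteq> fst ` set a \<union> fst ` set b"
    using \<pi> unfolding ovp_le_def ab by (auto simp: image_Un)
  have "{1..min m N} \<subseteq> fst ` set b"
  proof
    fix k assume k: "k \<in> {1..min m N}"
    then have "k \<in> fst ` set a \<union> fst ` set b" by (intro subsetD[OF cover]) auto
    then show "k \<in> fst ` set b" using a k by auto
  qed
  then have "b \<in> ovp_le N m" using s pos b by (auto simp: ovp_le_def)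
  moreover have "a \<noteq> []" if "Suc N \<le> m"
  proof
    assume "a = []"
    moreover have "Suc N \<in> {1..min m (Suc N)}" using that by auto
    ultimately have "Suc N \<in> fst ` set b" using subsetD[OF cover] by fastforce
    then show False using b by auto
  qed
  then have "a \<in> ovp_block (Suc N) m" using a s by (auto simp: ovp_block_def)
  ultimately show "\<pi> \<in> ?R" using ab by auto
next
  fix \<pi> assume "\<pi> \<in> ?R"
  then obtain a b where ab: "\<pi> = a @ b" "a \<in> ovp_block (Suc N) m" "b \<in> ovp_le N m" by auto
  have "ovp_rel x y" if "x \<in> set a" "y \<in> set b" for x y
    using that ab by (auto simp: ovp_rel_def ovp_block_def ovp_le_def)
  moreover have "{1..min m (Suc N)} \<subseteq> fst ` set \<pi>"
  proof
    fix k assume k: "k \<in> {1..min m (Suc N)}"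
    show "k \<in> fst ` set \<pi>"
    proof (cases "k = Suc N")
      case True
      then have "a \<noteq> []" using k ab by (auto simp: ovp_block_def)
      then have "hd a \<in> set a" by simp
      moreover from this have "fst (hd a) = k" using ab True by (auto simp: ovp_block_def)
      ultimately show ?thesis using ab by force
    next
      case False
      then have "k \<in> {1..min m N}" using k by auto
      then show ?thesis using ab by (auto simp: ovp_le_def)
    qed
  qed
  ultimately show "\<pi> \<in> ?L"
    using ab by (fastforce simp: ovp_le_def ovp_block_def sorted_wrt_append)
qed

text \<open>The block is recovered from the whole list by \<open>takeWhile\<close>, so the split is
  unique.\<close>

lemma inj_on_append_block: "inj_on (\<lambda>(a, b). a @ b) (ovp_block (Suc N) m \<times> ovp_le N m)"
proof (rule inj_onI, clarify)
  fix a b a' b' assume *: "a \<in> ovp_block (Suc N) m" "a' \<in> ovp_block (Suc N) m"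
    "b \<in> ovp_le N m" "b' \<in> ovp_le N m" "a @ b = a' @ b'"
  have "takeWhile (\<lambda>p. fst p = Suc N) (a @ b) = a"
    if "a \<in> ovp_block (Suc N) m" "b \<in> ovp_le N m" for a b
    by (rule takeWhile_block) (use that in \<open>auto simp: ovp_block_def ovp_le_def\<close>)
  then have "a = a'" using * by metis
  with * show "a = a' \<and> b = b'" by simp
qed

text \<open>Only the head of a block can be overlined, so a nonempty block is determined by one flag
  and the number of further copies.\<close>

lemma ovp_block_eq:
  "ovp_block N m = (if N \<le> m then {} else {[]}) \<union>
     (\<lambda>(f, k). (N, f) # replicate k (N, False)) ` UNIV" (is "_ = ?E \<union> ?I")
proof (intro equalityI subsetI)
  fix \<pi> assume \<pi>: "\<pi> \<in> ovp_block N m"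
  show "\<pi> \<in> ?E \<union> ?I"
  proof (cases \<pi>)
    case (Cons x xs)
    have "p = (N, False)" if "p \<in> set xs" for p
    proof -
      have "ovp_rel x p" "fst x = N" "fst p = N"
        using that \<pi> unfolding Cons by (simp_all add: ovp_block_def)
      then show ?thesis by (cases p) (simp add: ovp_rel_def)
    qed
    then obtain k where "xs = replicate k (N, False)"
      using replicate_eqI[of xs "length xs" "(N, False)"] by auto
    moreover obtain f where "x = (N, f)"
      using \<pi> Cons by (cases x) (simp add: ovp_block_def)
    ultimately have "\<pi> = (\<lambda>(f, k). (N, f) # replicate k (N, False)) (f, k)"
      using Cons by simp
    then show ?thesis by blast
  qed (use \<pi> in \<open>auto simp: ovp_block_def\<close>)
next
  fix \<pi> assume "\<pi> \<in> ?E \<union> ?I"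
  then show "\<pi> \<in> ovp_block N m"
    by (auto simp: ovp_block_def ovp_rel_def sorted_wrt_iff_nth_less nth_Cons' split: if_splits)
qed

lemma card_ovp_block:
  assumes "0 < N"
  shows "card {\<pi>\<in>ovp_block N m. weight \<pi> = n} =
    (if n = 0 then (if N \<le> m then 0 else 1) else if N dvd n then 2 else 0)"
proof -
  let ?g = "\<lambda>(f, k). (N, f) # replicate k (N, False)"
  have w: "weight (?g (f, k)) = N * Suc k" for f k
    by (simp add: weight_def sum_list_replicate)
  show ?thesis
  proof (cases "n = 0")
    case True
    then have "{\<pi>\<in>ovp_block N m. weight \<pi> = n} = (if N \<le> m then {} else {[]})"
      using assms unfolding ovp_block_eq by (auto simp: weight_def)
    then show ?thesis using True by simp
  next
    case False
    show ?thesis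
    proof (cases "N dvd n")
      case True
      then obtain k where k: "n = N * Suc k"
        using False by (metis dvdE mult_0_right not0_implies_Suc)
      have "{\<pi>\<in>ovp_block N m. weight \<pi> = n} = ?g ` (UNIV \<times> {k})"
        using False assms unfolding ovp_block_eq k by (auto simp: w[simplified] weight_def sum_list_replicate)
      also have "card \<dots> = card ((UNIV :: bool set) \<times> {k})"
        by (rule card_image) (auto simp: inj_on_def)
      finally show ?thesis using True False by (simp add: card_cartesian_product)
    next
      case nd: False
      have "{\<pi>\<in>ovp_block N m. weight \<pi> = n} = {}"
        using False nd w unfolding ovp_block_eq by (auto simp: weight_def split: if_splits)
      then show ?thesis using nd False by (simp only: card.empty if_False)
    qed
  qed
qed

text \<open>Multiplying by \<open>1 - fps_X ^ N\<close> subtracts the coefficient \<open>N\<close>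
  places earlier. The constant value 2 at positive multiples of \<open>N\<close> telescopes, and
  only the coefficients at 0 and \<open>N\<close> can survive.\<close>

lemma weight_gf_ovp_block:
  assumes "0 < N"
  shows "weight_gf (ovp_block N m) * (1 - fps_X ^ N) =
    (if N \<le> m then 2 * fps_X ^ N else 1 + fps_X ^ N :: 'a::comm_ring_1 fps)"
proof (rule fps_ext)
  fix n
  have "weight_gf (ovp_block N m) * (1 - fps_X ^ N) =
      weight_gf (ovp_block N m) - fps_X ^ N * (weight_gf (ovp_block N m) :: 'a fps)"
    by (simp add: algebra_simps)
  moreover have "N dvd n - N \<longleftrightarrow> N dvd n" if "N \<le> n"
    using that by (simp add: dvd_minus_self)
  moreover have "(2 * fps_X ^ N :: 'a fps) $ n = (if n = N then 2 else 0)"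
    by (simp add: numeral_fps_const)
  ultimately show "(weight_gf (ovp_block N m) * (1 - fps_X ^ N)) $ n =
      (if N \<le> m then 2 * fps_X ^ N else 1 + fps_X ^ N :: 'a fps) $ n"
    using assms
    by (auto simp: fps_X_power_mult_nth weight_gf_def card_ovp_block dest: dvd_imp_le)
qed

section \<open>Product formulas and their limit\<close>

lemma weight_gf_ovp_le:
  "weight_gf (ovp_le N m) * qpoch fps_X fps_X N =
     (\<Prod>k<N. if k < m then 2 * fps_X ^ Suc k else 1 + fps_X ^ Suc k :: 'a::field fps)"
proof (induction N)
  case 0
  have "{\<pi>. \<pi> = [] \<and> weight \<pi> = n} = (if n = 0 then {[]} else {})" for n
    by (auto simp: weight_def)
  then show ?case
    by (intro fps_ext) (simp add: ovp_le_0 weight_gf_def qpoch_def)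
next
  case (Suc N)
  have "weight_gf (ovp_le (Suc N) m) =
      weight_gf (ovp_block (Suc N) m) * (weight_gf (ovp_le N m) :: 'a fps)"
    unfolding ovp_le_Suc
    by (rule weight_gf_append[OF inj_on_append_block]) (auto simp: ovp_block_def ovp_le_def)
  then have "weight_gf (ovp_le (Suc N) m) * qpoch fps_X fps_X (Suc N) =
      (weight_gf (ovp_le N m) * qpoch fps_X fps_X N) *
      (weight_gf (ovp_block (Suc N) m) * (1 - fps_X ^ Suc N) :: 'a fps)"
    by (simp add: qpoch_def algebra_simps)
  \<comment> \<open>Index \<open>k\<close> stands for size \<open>Suc k\<close>, so
    \<open>k < m\<close> matches the condition \<open>Suc k <= m\<close> of the block
    formula.\<close>
  also have "\<dots> = (\<Prod>k<Suc N. if k < m then 2 * fps_X ^ Suc k else 1 + fps_X ^ Suc k)"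
    unfolding Suc.IH weight_gf_ovp_block[OF zero_less_Suc] by (simp add: Suc_le_eq)
  finally show ?case .
qed

lemma qpoch_neg_X_Suc:
  "qpoch (-fps_X) fps_X (Suc n) = qpoch (-fps_X) fps_X n * (1 + fps_X ^ Suc n)"
  by (simp add: qpoch_def)

text \<open>At \<open>N = m\<close> the exponents 1 to \<open>m\<close> add up to the binomial
  coefficient; every further factor \<open>1 + fps_X ^ Suc k\<close> extends both sides
  alike.\<close>

lemma prod_mult_qpoch:
  assumes "m \<le> N"
  shows "(\<Prod>k<N. if k < m then 2 * fps_X ^ Suc k else 1 + fps_X ^ Suc k) * qpoch (-fps_X) fps_X m
    = (2 ^ m * fps_X ^ ((m + 1) choose 2) * qpoch (-fps_X) fps_X N :: 'a::field fps)"
  using assms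
proof (induction N rule: dec_induct)
  case base
  have "(\<Prod>k<m. 2 * fps_X ^ Suc k) = (2 ^ m * fps_X ^ ((m + 1) choose 2) :: 'a fps)"
  proof (induction m)
    case (Suc m)
    have "Suc m + 1 choose 2 = (m + 1 choose 2) + Suc m"
      by (simp add: numeral_2_eq_2)
    then show ?case using Suc by (simp add: power_add algebra_simps)
  qed (simp add: numeral_2_eq_2)
  then show ?case by simp
next
  case (step N)
  then show ?case by (simp add: qpoch_neg_X_Suc mult_ac del: power_Suc)
qed

lemma weight_gf_ovp_containing:
  "weight_gf (ovp_containing m) * qpoch_inf fps_X fps_X * qpoch (-fps_X) fps_X m =
     (2 ^ m * fps_X ^ ((m + 1) choose 2) * qpoch_inf (-fps_X) fps_X :: 'a::field fps)"
proof (rule tendsto_unique)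
  have "(\<lambda>N. weight_gf (ovp_le N m)) \<longlonglongrightarrow> (weight_gf (ovp_containing m) :: 'a fps)"
  proof (rule tendsto_fpsI)
    fix n
    \<comment> \<open>A list of weight \<open>n\<close> has no part above \<open>n\<close>, so the
      size bound is vacuous for \<open>N >= n\<close>, and \<open>min m N = m\<close> for
      \<open>N >= m\<close>.\<close>
    have "{\<pi>\<in>ovp_le N m. weight \<pi> = n} = {\<pi>\<in>ovp_containing m. weight \<pi> = n}"
      if "max m n \<le> N" for N
      using that fst_le_weight by (fastforce simp: ovp_le_def ovp_containing_def min_absorb1)
    then show "eventually (\<lambda>N. weight_gf (ovp_le N m) $ n =
        (weight_gf (ovp_containing m) :: 'a fps) $ n) sequentially"
      using eventually_ge_at_top[of "max m n"] by (auto elim!: eventually_mono simp: weight_gf_def)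
  qed
  then show "(\<lambda>N. weight_gf (ovp_le N m) * qpoch fps_X fps_X N * qpoch (-fps_X) fps_X m) \<longlonglongrightarrow>
      (weight_gf (ovp_containing m) * qpoch_inf fps_X fps_X * qpoch (-fps_X) fps_X m :: 'a fps)"
    by (intro tendsto_fps_mult tendsto_const qpoch_inf_limit) auto
  have lim: "(\<lambda>N. 2 ^ m * fps_X ^ ((m + 1) choose 2) * qpoch (-fps_X) fps_X N) \<longlonglongrightarrow>
      (2 ^ m * fps_X ^ ((m + 1) choose 2) * qpoch_inf (-fps_X) fps_X :: 'a fps)"
    by (intro tendsto_fps_mult tendsto_const qpoch_inf_limit) auto
  show "(\<lambda>N. weight_gf (ovp_le N m) * qpoch fps_X fps_X N * qpoch (-fps_X) fps_X m) \<longlonglongrightarrow>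
      (2 ^ m * fps_X ^ ((m + 1) choose 2) * qpoch_inf (-fps_X) fps_X :: 'a fps)"
    \<comment> \<open>The finite identity requires \<open>m <= N\<close>, so the two sequences agree
      only eventually.\<close>
    by (rule Lim_transform_eventually[OF lim])
      (use eventually_ge_at_top[of m] in eventually_elim,
        simp only: weight_gf_ovp_le prod_mult_qpoch)
qed simp

lemma fps_eq_divideI:
  fixes a b c :: "'a::field fps"
  assumes "a * b = c" "b $ 0 \<noteq> 0"
  shows "a = c / b"
proof -
  have "b \<noteq> 0" using assms(2) by auto
  then show ?thesis using fps_divide_times_eq[of b a] assms(1) by simp
qed

section \<open>The mex\<close>

text \<open>This turns the mex into a count: exactly \<open>overmex \<pi>\<close> values of
  \<open>m\<close> satisfy the left side.\<close>

lemma atLeastAtMost_subset_iff_overmex: "{1..m} \<subseteq> fst ` set \<pi> \<longleftrightarrow> m < overmex \<pi>"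
proof -
  let ?P = "\<lambda>k. 0 < k \<and> k \<notin> fst ` set \<pi>"
  have "\<exists>k. ?P k"
    \<comment> \<open>Inserting 0 forces the fresh number to be positive.\<close>
    using ex_new_if_finite[of "insert 0 (fst ` set \<pi>)"] by auto
  then have P: "?P (overmex \<pi>)"
    unfolding overmex_def by (rule LeastI_ex)
  show ?thesis
  proof
    assume *: "{1..m} \<subseteq> fst ` set \<pi>"
    show "m < overmex \<pi>"
    proof (rule ccontr)
      assume "\<not> m < overmex \<pi>"
      then have "overmex \<pi> \<in> {1..m}" using P by auto
      then show False using P * by blast
    qed
  next
    assume *: "m < overmex \<pi>"
    show "{1..m} \<subseteq> fst ` set \<pi>"
    proof
      fix k assume k: "k \<in> {1..m}"
      then have "\<not> ?P k"
        using * unfolding overmex_def by (intro not_less_Least) simp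
      then show "k \<in> fst ` set \<pi>" using k by auto
    qed
  qed
qed

lemma overpartitions_0: "overpartitions 0 = {[]}"
proof -
  have "\<pi> = []" if "\<pi> \<in> overpartitions 0" for \<pi>
    using that length_le_weight[of \<pi>] by (simp add: overpartitions_altdef)
  moreover have "[] \<in> overpartitions 0"
    by (simp add: overpartitions_altdef weight_def)
  ultimately show ?thesis by blast
qed

text \<open>The convention at 0 agrees with the sum, since the empty list is the only overpartition
  of 0 and has mex 1.\<close>

lemma sigma_overmex_eq: "sigma_overmex n = (\<Sum>\<pi>\<in>overpartitions n. overmex \<pi>)"
proof (cases "n = 0")
  case True
  have "overmex [] = 1" unfolding overmex_def by (rule Least_equality) auto
  then show ?thesis using True by (simp add: sigma_overmex_def overpartitions_0)
qed (simp add: sigma_overmex_def)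

text \<open>Double counting of the pairs of \<open>m\<close> and an overpartition whose mex exceeds
  \<open>m\<close>.\<close>

lemma ovp_containing_sums:
  "(\<lambda>m. weight_gf (ovp_containing m)) sums (Abs_fps (\<lambda>n. of_nat (sigma_overmex n)) :: 'a::comm_ring_1 fps)"
  unfolding sums_def
proof (rule tendsto_fpsI)
  fix n
  have fibre: "{\<pi>\<in>ovp_containing m. weight \<pi> = n} = {\<pi>\<in>overpartitions n. m < overmex \<pi>}" for m
    unfolding ovp_containing_def overpartitions_altdef atLeastAtMost_subset_iff_overmex by auto
  \<comment> \<open>A part \<open>Suc n\<close> does not fit into weight \<open>n\<close>, so the
    mex is at most \<open>Suc n\<close> and later terms contribute nothing to coefficient
    \<open>n\<close>.\<close>
  have partial: "(\<Sum>m<M. card {\<pi>\<in>ovp_containing m. weight \<pi> = n}) = sigma_overmex n"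
    if M: "Suc n \<le> M" for M
  proof -
    have le: "overmex \<pi> \<le> M" if "\<pi> \<in> overpartitions n" for \<pi>
    proof -
      have "Suc n \<notin> fst ` set \<pi>"
        using that fst_le_weight[of _ \<pi>] by (force simp: overpartitions_altdef)
      then have "overmex \<pi> \<le> Suc n" unfolding overmex_def by (intro Least_le) auto
      then show ?thesis using M by simp
    qed
    have "(\<Sum>m<M. card {\<pi>\<in>overpartitions n. m < overmex \<pi>}) =
        (\<Sum>m<M. \<Sum>\<pi>\<in>overpartitions n. if m < overmex \<pi> then 1 else 0)"
      by (simp add: sum.If_cases finite_overpartitions Int_def)
    also have "\<dots> = (\<Sum>\<pi>\<in>overpartitions n. \<Sum>m<M. if m < overmex \<pi> then 1 else 0)"
      by (rule sum.swap)
    also have "\<dots> = (\<Sum>\<pi>\<in>overpartitions n. overmex \<pi>)"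
    proof (rule sum.cong)
      fix \<pi> assume "\<pi> \<in> overpartitions n"
      then have "{..<M} \<inter> {m. m < overmex \<pi>} = {..<overmex \<pi>}" using le by fastforce
      then show "(\<Sum>m<M. if m < overmex \<pi> then 1 else 0) = overmex \<pi>"
        by (simp add: sum.If_cases)
    qed simp
    finally show ?thesis by (simp add: fibre sigma_overmex_eq)
  qed
  show "eventually (\<lambda>M. (\<Sum>m<M. weight_gf (ovp_containing m)) $ n =
      (Abs_fps (\<lambda>n. of_nat (sigma_overmex n)) :: 'a fps) $ n) sequentially"
    using eventually_ge_at_top[of "Suc n"]
    by eventually_elim (simp add: weight_gf_def fps_sum_nth partial flip: of_nat_sum)
qed

section \<open>The hypergeometric series and the final identity\<close>

lemma overpartition_gf_eq: "overpartition_gf = weight_gf (ovp_containing 0)"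
  by (simp add: overpartition_gf_def weight_gf_def ovp_containing_def overpartitions_altdef conj_assoc)

text \<open>The numerator cancels \<open>qpoch q q n\<close> in the denominator, the two signs
  cancel, and \<open>z ^ n\<close> raises the exponent from \<open>n choose 2\<close> to
  \<open>(n + 1) choose 2\<close>.\<close>

lemma phi_1_1_eq:
  "phi_1_1 fps_X (-fps_X) fps_X (-2 * fps_X) =
     (\<Sum>n. 2 ^ n * fps_X ^ ((n + 1) choose 2) / qpoch (-fps_X) fps_X n :: 'a::field fps)"
  unfolding phi_1_1_def
proof (rule arg_cong[of _ _ suminf], rule ext)
  fix n
  let ?p = "qpoch fps_X fps_X n :: 'a fps" and ?r = "qpoch (-fps_X) fps_X n :: 'a fps"
  have pr: "?p $ 0 \<noteq> 0" "?r $ 0 \<noteq> 0" by (simp_all add: qpoch_nth_0)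
  have "?p / (?r * ?p) = 1 / ?r"
    using fps_divide_cancel[of ?p 1 ?r] pr by fastforce
  moreover have "(n + 1) choose 2 = (n choose 2) + n"
    by (simp add: numeral_2_eq_2)
  moreover have "(-1) ^ n * (-2 * fps_X) ^ n = (2 ^ n * fps_X ^ n :: 'a fps)"
  proof -
    have "(-1) ^ n * (-2 * fps_X) ^ n = (2 * fps_X :: 'a fps) ^ n"
      by (subst power_mult_distrib[symmetric]) simp
    then show ?thesis by (simp only: power_mult_distrib)
  qed
  ultimately show "?p / (?r * ?p) * (- 1) ^ n * fps_X ^ (n choose 2) * (-2 * fps_X) ^ n =
      2 ^ n * fps_X ^ ((n + 1) choose 2) / ?r"
    using pr by (simp add: fps_divide_unit power_add mult_ac)
qed

theorem theorem1p7:
  fixes q :: "'a::field_char_0 fps"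
  assumes q: "q = fps_X"
  shows "Abs_fps (\<lambda>n. of_nat (sigma_overmex n)) =
           qpoch_inf (-q) q / qpoch_inf q q *
             (\<Sum>m. 2 ^ m * q ^ ((m + 1) choose 2) / qpoch (-q) q m)
       \<and> Abs_fps (\<lambda>n. of_nat (sigma_overmex n)) =
           overpartition_gf * phi_1_1 q (-q) q (-2 * q)
       \<and> overpartition_gf = qpoch_inf (-q) q / qpoch_inf q q
       \<and> phi_1_1 q (-q) q (-2 * q) =
           (\<Sum>n. 2 ^ n * q ^ ((n + 1) choose 2) / qpoch (-q) q n)"
proof -
  define A B :: "'a fps" where "A = qpoch_inf (-q) q" "B = qpoch_inf q q"
  define t where "t m = 2 ^ m * q ^ ((m + 1) choose 2) / qpoch (-q) q m" for m
  define S :: "'a fps" where "S = Abs_fps (\<lambda>n. of_nat (sigma_overmex n))"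
  have unit: "A $ 0 = 1" "B $ 0 = 1" "qpoch (-q) q m $ 0 = 1" for m
    by (simp_all add: A_B_def q qpoch_inf_limit(2) qpoch_nth_0)
  \<comment> \<open>For \<open>m = 0\<close> nothing is required to occur, and the formula reduces
    to the generating function of all overpartitions.\<close>
  have gf: "overpartition_gf = A / B"
    using weight_gf_ovp_containing[of 0, where 'a = 'a] unit
    by (intro fps_eq_divideI) (simp_all add: A_B_def q overpartition_gf_eq qpoch_def numeral_2_eq_2)
  have t: "weight_gf (ovp_containing m) * (B / A) = t m" for m
    unfolding t_def
  proof (rule fps_eq_divideI)
    have "weight_gf (ovp_containing m) * (B / A) * qpoch (-q) q m =
        weight_gf (ovp_containing m) * B * qpoch (-q) q m * inverse A"
      using unit by (simp add: fps_divide_unit mult_ac)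
    also have "\<dots> = 2 ^ m * q ^ ((m + 1) choose 2) * (A * inverse A)"
      unfolding A_B_def q weight_gf_ovp_containing by (simp add: mult_ac)
    finally show "weight_gf (ovp_containing m) * (B / A) * qpoch (-q) q m =
        2 ^ m * q ^ ((m + 1) choose 2)"
      using unit by (simp add: inverse_mult_eq_1')
  qed (simp add: unit)
  \<comment> \<open>Scaling the known convergent series by \<open>B / A\<close> shows that
    \<open>t\<close> is summable, so \<open>suminf t\<close> is a genuine limit; multiplying by
    \<open>A / B\<close> then undoes the scaling.\<close>
  have "(\<lambda>n. (\<Sum>m<n. weight_gf (ovp_containing m)) * (B / A)) \<longlonglongrightarrow> S * (B / A)"
    using ovp_containing_sums unfolding S_def sums_def by (intro tendsto_fps_mult tendsto_const)
  then have "t sums (S * (B / A))"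
    by (simp add: sums_def sum_distrib_right t)
  then have "suminf t = S * (B / A)"
    by (simp add: sums_iff)
  moreover have "A / B * (S * (B / A)) = S * ((A * inverse A) * (B * inverse B))"
    using unit by (simp add: fps_divide_unit mult_ac)
  ultimately have "S = A / B * suminf t"
    using unit by (simp add: inverse_mult_eq_1')
  moreover have "phi_1_1 q (-q) q (-2 * q) = suminf t"
    unfolding q t_def[abs_def] by (rule phi_1_1_eq)
  ultimately show ?thesis
    using gf by (simp add: S_def t_def[abs_def] A_B_def)
qed

end
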